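(* For all $n\ge 2$ and any permutation $w\in S_n$, the twisted Kirillov polynomial $\mathcal{KN}_w^{(-\alpha,-\beta,\alpha+\beta)}(\boldsymbol{x};\boldsymbol{0})$ is in $\mathbb{N}[\alpha,\beta][x_1,x_2,\ldots,x_n]$.
   Context: $\mathbb{N}$ denotes the nonnegative integers. For parameters $\alpha,\beta,\gamma$, let $\partial_i(f)=\dfrac{f(x_1,\ldots,x_{i-1},x_{i+1},x_i,x_{i+2},\ldots,x_n)-f(x_1,\ldots,x_n)}{x_{i+1}-x_i}$ and, for $1\le i\le n-1$, $$T_i^{(\alpha,\beta,\gamma)}=-\beta+\big((\alpha+\beta+\gamma)x_i+\gamma x_{i+1}+1+(\beta+\gamma)(\alpha+\gamma)x_ix_{i+1}\big)\partial_i .$$ These operators satisfy the braid relations, so $T_w^{(\alpha,\beta,\gamma)}=T_{i_1}^{(\alpha,\beta,\gamma)}\circ\cdots\circ T_{i_\ell}^{(\alpha,\beta,\gamma)}$ is well defined for any reduced decomposition $w=s_{i_1}\cdots s_{i_\ell}\in S_n$. Then $\mathcal{KN}_w^{(\alpha,\beta,\gamma)}(\boldsymbol{x};\boldsymbol{0})=T_w^{(\alpha,\beta,\gamma)}(x_1^{n-1}x_2^{n-2}\cdots x_{n-1})$. The polynomial $\mathcal{KN}_w^{(-\alpha,-\beta,\alpha+\beta)}(\boldsymbol{x};\boldsymbol{0})$ is obtained by substituting $(-\alpha,-\beta,\alpha+\beta)$ for $(\alpha,\beta,\gamma)$, with $\alpha,\beta,x_1,\ldots,x_n$ indeterminates.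 *)

theory Defs
  imports
    "HOL-Library.Poly_Mapping"
    "HOL-Computational_Algebra.Polynomial"
    "HOL-Combinatorics.Permutations"
begin

text \<open>
  Polynomials over a ring \<open>'a\<close> in variables \<open>x\<^sub>0, x\<^sub>1, x\<^sub>2, \<dots>\<close>, as finitely supported coefficient
  functions on exponent vectors; multiplication is the convolution product of
  \<open>Poly_Mapping\<close>.  Membership in the subring on \<open>x\<^sub>1, \<dots>, x\<^sub>n\<close> is expressed by
  \<open>polys_over\<close> below.
\<close>

type_synonym 'a mpoly = "(nat \<Rightarrow>\<^sub>0 nat) \<Rightarrow>\<^sub>0 'a"

definition X :: "nat \<Rightarrow> 'a::comm_ring_1 mpoly" where
  "X i = Poly_Mapping.single (Poly_Mapping.single i 1) 1"

definition C :: "'a \<Rightarrow> 'a::comm_ring_1 mpoly" where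
  "C c = Poly_Mapping.single 0 c"

definition subst :: "(nat \<Rightarrow> 'a mpoly) \<Rightarrow> 'a mpoly \<Rightarrow> 'a::comm_ring_1 mpoly" where
  "subst \<sigma> f =
     (\<Sum>m\<in>Poly_Mapping.keys f. C (Poly_Mapping.lookup f m) *
        (\<Prod>j\<in>Poly_Mapping.keys m. \<sigma> j ^ Poly_Mapping.lookup m j))"

definition polys_over :: "'a set \<Rightarrow> nat set \<Rightarrow> 'a::comm_ring_1 mpoly set" where
  "polys_over A V =
     {f. (\<forall>m. Poly_Mapping.lookup f m \<in> A) \<and> (\<forall>m\<in>Poly_Mapping.keys f. Poly_Mapping.keys m \<subseteq> V)}"

text \<open>
  The division is exact: \<open>x\<^bsub>i+1\<^esub> - x\<^sub>i\<close> is not a zero divisor and divides the numerator, so the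
  quotient exists and is unique.
\<close>

definition divided_diff :: "nat \<Rightarrow> 'a mpoly \<Rightarrow> 'a::comm_ring_1 mpoly" where
  "divided_diff i f =
     (THE g. (X (Suc i) - X i) * g = subst (\<lambda>j. X (transpose i (Suc i) j)) f - f)"

definition T_op :: "'a \<Rightarrow> 'a \<Rightarrow> 'a \<Rightarrow> nat \<Rightarrow> 'a mpoly \<Rightarrow> 'a::comm_ring_1 mpoly" where
  "T_op \<alpha> \<beta> \<gamma> i f =
     - C \<beta> * f
     + (C (\<alpha> + \<beta> + \<gamma>) * X i + C \<gamma> * X (Suc i) + 1
        + C ((\<beta> + \<gamma>) * (\<alpha> + \<gamma>)) * X i * X (Suc i)) * divided_diff i f"

text \<open>
  A list \<open>[i\<^sub>1, \<dots>, i\<^sub>l]\<close> stands for the word \<open>s\<^bsub>i\<^sub>1\<^esub> \<dots> s\<^bsub>i\<^sub>l\<^esub>\<close> in the adjacent transpositions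
  \<open>s\<^sub>i = (i, i+1)\<close>, the product being composition of functions.
\<close>

definition word_perm :: "nat list \<Rightarrow> nat \<Rightarrow> nat" where
  "word_perm is = foldr (\<lambda>i p. transpose i (Suc i) \<circ> p) is id"

definition decomposition :: "nat \<Rightarrow> (nat \<Rightarrow> nat) \<Rightarrow> nat list \<Rightarrow> bool" where
  "decomposition n w is \<longleftrightarrow> set is \<subseteq> {1..n - 1} \<and> word_perm is = w"

definition reduced_decomposition :: "nat \<Rightarrow> (nat \<Rightarrow> nat) \<Rightarrow> nat list \<Rightarrow> bool" where
  "reduced_decomposition n w is \<longleftrightarrow>
     decomposition n w is \<and> (\<forall>js. decomposition n w js \<longrightarrow> length is \<le> length js)"

text \<open>
  By the braid relations the result does not depend on which reduced decomposition is chosen.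
\<close>

definition T_perm ::
  "nat \<Rightarrow> 'a \<Rightarrow> 'a \<Rightarrow> 'a \<Rightarrow> (nat \<Rightarrow> nat) \<Rightarrow> 'a mpoly \<Rightarrow> 'a::comm_ring_1 mpoly" where
  "T_perm n \<alpha> \<beta> \<gamma> w = foldr (T_op \<alpha> \<beta> \<gamma>) (SOME is. reduced_decomposition n w is)"

definition KN ::
  "nat \<Rightarrow> 'a \<Rightarrow> 'a \<Rightarrow> 'a \<Rightarrow> (nat \<Rightarrow> nat) \<Rightarrow> 'a::comm_ring_1 mpoly" where
  "KN n \<alpha> \<beta> \<gamma> w = T_perm n \<alpha> \<beta> \<gamma> w (\<Prod>i\<in>{1..n}. X i ^ (n - i))"

text \<open>
  The coefficient ring \<open>\<int>[\<alpha>,\<beta>]\<close> is the type \<open>int poly poly\<close>, with \<open>\<alpha>\<close> the indeterminate of the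
  inner and \<open>\<beta>\<close> that of the outer polynomial type.
\<close>

definition ind_\<alpha> :: "int poly poly" where
  "ind_\<alpha> = [:[:0, 1:]:]"

definition ind_\<beta> :: "int poly poly" where
  "ind_\<beta> = [:0, 1:]"

definition nat_polys_\<alpha>\<beta> :: "int poly poly set" where
  "nat_polys_\<alpha>\<beta> = {p. \<forall>i j. coeff (coeff p i) j \<in> \<nat>}"

end

theory Submission
  imports Defs
begin

text \<open>
  After the substitution the operators are \<open>T\<^sub>i = \<beta> + P\<^sub>i \<partial>\<^sub>i\<close> with
  \<open>P\<^sub>i = 1 + (\<alpha> + \<beta>) x\<^bsub>i+1\<^esub> + \<alpha> \<beta> x\<^sub>i x\<^bsub>i+1\<^esub>\<close>.  They satisfy \<open>(T\<^sub>i - \<beta>) (T\<^sub>i + \<alpha>) = 0\<close>, so they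
  generate a Hecke algebra with two invertible eigenvalues, and this is the algebra that governs
  coloured vertex models.  The idea is to write the polynomials as partition functions of a vertex
  model all of whose weights have nonnegative coefficients.

  The model has \<open>n\<close> rows, carrying the variables \<open>x\<^sub>1, \<dots>, x\<^sub>n\<close>, and \<open>n\<close> columns.  A horizontal edge
  carries one of the colours \<open>1, \<dots>, n\<close> or is empty, a vertical edge carries a set of colours.
  Row \<open>j\<close> is entered from the left by the colour \<open>w j\<close>; each column emits one colour, the
  leftmost one the colour \<open>n\<close>, the next one \<open>n - 1\<close>, and so on.  Inside a column the rows are passed
  in the order \<open>n, \<dots>, 1\<close>.  Let \<open>F w\<close> be the resulting partition function.  Three facts give the theorem.

  First, the weights of two neighbouring rows satisfy a Yang-Baxter type relation
  (\<open>exchange_identity\<close>).  Pushed through the columns it says how \<open>F w\<close> behaves when \<open>x\<^sub>i\<close> and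
  \<open>x\<^bsub>i+1\<^esub>\<close> are interchanged (\<open>exchange_partition_fun\<close>); for \<open>w i < w (i + 1)\<close> this relation is
  precisely \<open>T\<^sub>i (F w) = \<beta> F (w s\<^sub>i)\<close> (\<open>T_op_partition_fun\<close>).  Second, for the increasing word
  \<open>1, 2, \<dots>, n\<close> only one configuration has a nonzero weight, which is a power of \<open>\<beta>\<close> times
  \<open>x\<^sub>1\<^bsup>n-1\<^esup> x\<^sub>2\<^bsup>n-2\<^esup> \<cdots> x\<^bsub>n-1\<^esub>\<close> (\<open>partition_fun_sorted\<close>).  Third, along a reduced word every letter
  meets an ascent (\<open>reduced_decomposition_Cons\<close>).  Together: some power of \<open>\<beta>\<close> times the polynomial
  of a permutation is a power of \<open>\<beta>\<close> times the value of \<open>F\<close> at the inverse permutation.  The right-hand side is visibly positive, and dividing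
  by a power of the indeterminate \<open>\<beta>\<close> only shifts coefficients.

  It is the starting monomial that calls for vertical edges with several colours.  In the model with
  at most one colour on every edge, a vertex of row \<open>j\<close> all of whose edges are empty has the weight
  \<open>1 + (\<alpha> + \<beta>) x\<^sub>j\<close> instead of 1, and the increasing word yields a different product.
\<close>


section \<open>Substitution, divided differences and coefficients of polynomials\<close>

lemma C_add: "C (c + d) = C c + C d"
  and C_mult: "C (c * d) = C c * C d"
  and C_uminus: "C (- c) = - C c"
  and C_0 [simp]: "C 0 = 0"
  and C_1 [simp]: "C 1 = 1"
  by (simp_all add: C_def single_add mult_single single_uminus)

lemma C_power: "C (c ^ k) = C c ^ k"
  by (induction k) (simp_all add: C_mult)

lemma poly_mapping_expand:
  "f = (\<Sum>m\<in>Poly_Mapping.keys f. Poly_Mapping.single m (Poly_Mapping.lookup f m))"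
proof (rule poly_mapping_eqI)
  fix k
  show "Poly_Mapping.lookup f k =
    Poly_Mapping.lookup (\<Sum>m\<in>Poly_Mapping.keys f. Poly_Mapping.single m (Poly_Mapping.lookup f m)) k"
    by (simp add: lookup_sum lookup_single when_def sum.delta in_keys_iff)
qed

lemma prod_single:
  "(\<Prod>i\<in>I. Poly_Mapping.single (e i) (1 :: 'a::comm_semiring_1)) = Poly_Mapping.single (\<Sum>i\<in>I. e i) 1"
  by (induction I rule: infinite_finite_induct) (simp_all add: mult_single)

lemma X_power: "X j ^ k = Poly_Mapping.single (Poly_Mapping.single j k) 1"
  by (induction k) (simp_all add: X_def mult_single flip: single_add)

lemma single_eq_C_mult:
  "Poly_Mapping.single m c = C c * (\<Prod>j\<in>Poly_Mapping.keys m. X j ^ Poly_Mapping.lookup m j)"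
  by (simp add: X_power prod_single C_def mult_single flip: poly_mapping_expand)

lemma mpoly_induct [case_names C X add mult]:
  assumes "\<And>c. P (C c)" "\<And>j. P (X j)"
    and add: "\<And>f g. P f \<Longrightarrow> P g \<Longrightarrow> P (f + g)"
    and mult: "\<And>f g. P f \<Longrightarrow> P g \<Longrightarrow> P (f * g)"
  shows "P (f :: 'a::comm_ring_1 mpoly)"
proof -
  have [simp]: "P 0" "P 1"
    using assms(1)[of 0] assms(1)[of 1] by simp_all
  have pow: "P (X j ^ k)" for j k
    by (induction k) (simp_all add: assms)
  have prod: "P (\<Prod>j\<in>K. X j ^ e j)" for K e
    by (induction K rule: infinite_finite_induct) (simp_all add: assms pow)
  have sum: "(\<And>m. P (g m)) \<Longrightarrow> P (\<Sum>m\<in>M. g m)" for M and g :: "_ \<Rightarrow> 'a mpoly"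
    by (induction M rule: infinite_finite_induct) (simp_all add: assms)
  show ?thesis
    by (subst poly_mapping_expand) (auto simp: single_eq_C_mult intro!: sum assms prod)
qed

lemma mult_expand:
  "f * g = (\<Sum>m\<in>Poly_Mapping.keys f. \<Sum>m'\<in>Poly_Mapping.keys g.
      Poly_Mapping.single (m + m') (Poly_Mapping.lookup f m * Poly_Mapping.lookup g m'))"
  by (subst poly_mapping_expand[of f], subst poly_mapping_expand[of g])
    (simp add: sum_product mult_single)

definition monom_subst :: "(nat \<Rightarrow> 'a mpoly) \<Rightarrow> (nat \<Rightarrow>\<^sub>0 nat) \<Rightarrow> 'a::comm_ring_1 mpoly" where
  "monom_subst \<sigma> m = (\<Prod>j\<in>Poly_Mapping.keys m. \<sigma> j ^ Poly_Mapping.lookup m j)"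

lemma monom_subst_superset:
  "finite S \<Longrightarrow> Poly_Mapping.keys m \<subseteq> S \<Longrightarrow> monom_subst \<sigma> m = (\<Prod>j\<in>S. \<sigma> j ^ Poly_Mapping.lookup m j)"
  unfolding monom_subst_def by (rule prod.mono_neutral_left) (auto simp: in_keys_iff)

lemma monom_subst_add: "monom_subst \<sigma> (m + m') = monom_subst \<sigma> m * monom_subst \<sigma> m'"
proof -
  let ?S = "Poly_Mapping.keys m \<union> Poly_Mapping.keys m'"
  have "monom_subst \<sigma> (m + m') = (\<Prod>j\<in>?S. \<sigma> j ^ Poly_Mapping.lookup (m + m') j)"
    using keys_add[of m m'] by (intro monom_subst_superset) auto
  also have "\<dots> = monom_subst \<sigma> m * monom_subst \<sigma> m'"
    by (simp add: lookup_add power_add prod.distrib monom_subst_superset[of ?S])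
  finally show ?thesis .
qed

lemma subst_superset:
  "finite S \<Longrightarrow> Poly_Mapping.keys f \<subseteq> S \<Longrightarrow>
    subst \<sigma> f = (\<Sum>m\<in>S. C (Poly_Mapping.lookup f m) * monom_subst \<sigma> m)"
  unfolding subst_def monom_subst_def by (rule sum.mono_neutral_left) (auto simp: in_keys_iff)

lemma subst_0 [simp]: "subst \<sigma> 0 = 0"
  by (simp add: subst_def)

lemma subst_add: "subst \<sigma> (f + g) = subst \<sigma> f + subst \<sigma> g"
proof -
  let ?S = "Poly_Mapping.keys f \<union> Poly_Mapping.keys g"
  have "subst \<sigma> (f + g) = (\<Sum>m\<in>?S. C (Poly_Mapping.lookup (f + g) m) * monom_subst \<sigma> m)"
    using keys_add[of f g] by (intro subst_superset) auto
  also have "\<dots> = subst \<sigma> f + subst \<sigma> g"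
    by (simp add: lookup_add C_add distrib_right sum.distrib subst_superset[of ?S])
  finally show ?thesis .
qed

lemma subst_sum: "subst \<sigma> (\<Sum>i\<in>I. g i) = (\<Sum>i\<in>I. subst \<sigma> (g i))"
  by (induction I rule: infinite_finite_induct) (simp_all add: subst_add)

lemma subst_single: "subst \<sigma> (Poly_Mapping.single m c) = C c * monom_subst \<sigma> m"
  by (subst subst_superset[of "{m}"]) auto

lemma subst_mult: "subst \<sigma> (f * g) = subst \<sigma> f * subst \<sigma> g"
  by (simp add: mult_expand[of f g] subst_sum subst_single C_mult monom_subst_add)
    (simp add: subst_def monom_subst_def sum_product ac_simps)

lemma subst_C [simp]: "subst \<sigma> (C c) = C c"
  by (simp add: C_def subst_single monom_subst_def mult_single flip: single_one)

lemma subst_1 [simp]: "subst \<sigma> 1 = 1"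
  using subst_C[of \<sigma> 1] by simp

lemma subst_X [simp]: "subst \<sigma> (X j) = \<sigma> j"
  by (simp add: X_def subst_single monom_subst_def)

lemma subst_power: "subst \<sigma> (f ^ k) = subst \<sigma> f ^ k"
  by (induction k) (simp_all add: subst_mult)

lemma subst_prod: "subst \<sigma> (\<Prod>i\<in>I. g i) = (\<Prod>i\<in>I. subst \<sigma> (g i))"
  by (induction I rule: infinite_finite_induct) (simp_all add: subst_mult)

lemmas subst_hom = subst_add subst_mult subst_power subst_sum subst_prod

abbreviation swap_vars :: "nat \<Rightarrow> 'a mpoly \<Rightarrow> 'a::comm_ring_1 mpoly" where
  "swap_vars i \<equiv> subst (\<lambda>j. X (transpose i (Suc i) j))"

lemma X_eq_iff [simp]: "X i = (X j :: 'a::comm_ring_1 mpoly) \<longleftrightarrow> i = j"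
proof
  assume "X i = (X j :: 'a mpoly)"
  then have "Poly_Mapping.lookup (X i :: 'a mpoly) (Poly_Mapping.single i 1) =
      Poly_Mapping.lookup (X j :: 'a mpoly) (Poly_Mapping.single i 1)" by simp
  then have "Poly_Mapping.single j (1::nat) = Poly_Mapping.single i 1"
    by (simp add: X_def lookup_single when_def split: if_splits)
  then show "i = j"
    by (metis keys_single singleton_insert_inj_eq zero_neq_one)
qed simp

text \<open>
  The polynomials whose difference with their image under the interchange \<open>s\<close> of \<open>x\<^sub>i\<close> and
  \<open>x\<^bsub>i+1\<^esub>\<close> is a multiple of \<open>x\<^bsub>i+1\<^esub> - x\<^sub>i\<close> form a subring, by the Leibniz rule
  \<open>s (f g) - f g = s f (s g - g) + (s f - f) g\<close>.
\<close>

lemma divided_diff_exists: "X (Suc i) - X i dvd swap_vars i f - f"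
proof (induction f rule: mpoly_induct)
  case (X j)
  show ?case
    by (auto simp: transpose_def intro: dvd_minus_iff[THEN iffD1, of _ "X _ - X _"])
next
  case (add f g)
  then have "X (Suc i) - X i dvd (swap_vars i f - f) + (swap_vars i g - g)"
    by (rule dvd_add)
  then show ?case by (simp add: subst_add algebra_simps)
next
  case (mult f g)
  then have "X (Suc i) - X i dvd swap_vars i f * (swap_vars i g - g) + (swap_vars i f - f) * g"
    by (intro dvd_add) auto
  then show ?case by (simp add: subst_mult algebra_simps)
qed auto

lemma divided_diff:
  "(X (Suc i) - X i) * divided_diff i f = swap_vars i f - (f :: 'a::idom mpoly)"
proof -
  obtain g where g: "swap_vars i f - f = (X (Suc i) - X i) * g"
    using divided_diff_exists by (rule dvdE)
  show ?thesis
    unfolding divided_diff_def g by (rule theI[where a = g]) auto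
qed

lemma divided_diff_C_mult:
  "divided_diff i (C c * f) = C c * divided_diff i (f :: 'a::idom mpoly)"
proof -
  have "(X (Suc i) - X i) * divided_diff i (C c * f) = C c * ((X (Suc i) - X i) * divided_diff i f)"
    by (simp only: divided_diff subst_mult subst_C right_diff_distrib)
  then have "(X (Suc i) - X i) * divided_diff i (C c * f) = (X (Suc i) - X i) * (C c * divided_diff i f)"
    by (simp only: mult.left_commute)
  then show ?thesis by simp
qed

lemma T_op_C_mult: "T_op \<alpha> \<beta> \<gamma> i (C c * f) = C c * T_op \<alpha> \<beta> \<gamma> i (f :: 'a::idom mpoly)"
  unfolding T_op_def divided_diff_C_mult by (simp add: algebra_simps)

text \<open>
  Multiplying by \<open>x\<^bsub>i+1\<^esub> - x\<^sub>i\<close> trades the divided difference for the interchange of the two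
  variables.  The coefficient of \<open>f\<close> is \<open>\<beta> (x\<^bsub>i+1\<^esub> - x\<^sub>i) - P\<^sub>i\<close>, and it is its factorization that
  makes local vertex weights possible.
\<close>

lemma T_op_twisted:
  fixes f :: "'a::idom mpoly"
  shows "(X (Suc i) - X i) * T_op (- a) (- b) (a + b) i f =
    (1 + (C a + C b) * X (Suc i) + C a * C b * X i * X (Suc i)) * swap_vars i f
    - (1 + C b * X i) * (1 + C a * X (Suc i)) * f"
proof -
  let ?P = "1 + (C a + C b) * X (Suc i) + C a * C b * X i * X (Suc i)"
  have "T_op (- a) (- b) (a + b) i f = C b * f + ?P * divided_diff i f"
    by (simp add: T_op_def C_add C_mult C_uminus algebra_simps)
  then have "(X (Suc i) - X i) * T_op (- a) (- b) (a + b) i f =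
      C b * (X (Suc i) - X i) * f + ?P * ((X (Suc i) - X i) * divided_diff i f)"
    by (simp add: algebra_simps)
  also have "\<dots> = C b * (X (Suc i) - X i) * f + ?P * (swap_vars i f - f)"
    by (simp only: divided_diff)
  finally show ?thesis by (simp add: algebra_simps)
qed

lemma polys_over_single:
  "c \<in> A \<Longrightarrow> 0 \<in> A \<Longrightarrow> Poly_Mapping.keys m \<subseteq> V \<Longrightarrow> Poly_Mapping.single m c \<in> polys_over A V"
  by (auto simp: polys_over_def lookup_single when_def split: if_splits)

locale coeff_semiring =
  fixes A :: "'a::comm_ring_1 set"
  assumes zero_mem [simp]: "0 \<in> A"
    and one_mem [simp]: "1 \<in> A"
    and add_mem: "c \<in> A \<Longrightarrow> d \<in> A \<Longrightarrow> c + d \<in> A"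
    and mult_mem: "c \<in> A \<Longrightarrow> d \<in> A \<Longrightarrow> c * d \<in> A"
begin

lemma polys_over_C: "c \<in> A \<Longrightarrow> C c \<in> polys_over A V"
  unfolding C_def by (rule polys_over_single) auto

lemma polys_over_0: "0 \<in> polys_over A V"
  by (simp add: polys_over_def)

lemma polys_over_1: "1 \<in> polys_over A V"
  using polys_over_C[of 1] by simp

lemma polys_over_X: "j \<in> V \<Longrightarrow> X j \<in> polys_over A V"
  unfolding X_def by (rule polys_over_single) auto

lemma polys_over_add: "f \<in> polys_over A V \<Longrightarrow> g \<in> polys_over A V \<Longrightarrow> f + g \<in> polys_over A V"
  using keys_add[of f g] by (fastforce simp: polys_over_def lookup_add add_mem)

lemma polys_over_sum: "(\<And>i. i \<in> I \<Longrightarrow> g i \<in> polys_over A V) \<Longrightarrow> (\<Sum>i\<in>I. g i) \<in> polys_over A V"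
  by (induction I rule: infinite_finite_induct) (auto simp: polys_over_0 polys_over_add)

lemma polys_over_mult:
  assumes "f \<in> polys_over A V" "g \<in> polys_over A V" 
  shows "f * g \<in> polys_over A V"
proof -
  have "Poly_Mapping.single (m + m') (Poly_Mapping.lookup f m * Poly_Mapping.lookup g m') \<in> polys_over A V"
    if "m \<in> Poly_Mapping.keys f" "m' \<in> Poly_Mapping.keys g" for m m'
    using that assms keys_add[of m m']
    by (intro polys_over_single) (fastforce simp: polys_over_def mult_mem)+
  then show ?thesis
    by (subst mult_expand) (intro polys_over_sum)
qed

lemma polys_over_prod: "(\<And>i. i \<in> I \<Longrightarrow> g i \<in> polys_over A V) \<Longrightarrow> (\<Prod>i\<in>I. g i) \<in> polys_over A V"
  by (induction I rule: infinite_finite_induct) (auto simp: polys_over_1 polys_over_mult)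

lemma polys_over_power: "f \<in> polys_over A V \<Longrightarrow> f ^ k \<in> polys_over A V"
  by (induction k) (auto simp: polys_over_1 polys_over_mult)

lemmas polys_over_closed = polys_over_0 polys_over_1 polys_over_X polys_over_add
  polys_over_mult polys_over_sum polys_over_prod polys_over_power

end

section \<open>Vertex weights and the exchange identity\<close>

text \<open>
  The homogeneous \<open>q\<close>-integer \<open>(a\<^sup>m - b\<^sup>m) / (a - b)\<close>.
\<close>

fun qint :: "'a::comm_ring_1 \<Rightarrow> 'a \<Rightarrow> nat \<Rightarrow> 'a" where
  "qint a b 0 = 0"
| "qint a b (Suc m) = b ^ m + a * qint a b m"

lemma qint_rec: "qint a b (Suc (Suc m)) = (a + b) * qint a b (Suc m) - a * b * qint a b m"
  by (simp add: algebra_simps)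

text \<open>
  A vertex with parameter \<open>x\<close> has a vertical incoming edge with colour set \<open>I\<close> and a horizontal
  incoming edge of colour \<open>h\<close>; its outgoing horizontal edge has the colour \<open>k\<close>.  Colour 0 stands for an
  empty horizontal edge and never belongs to \<open>I\<close>.  Colours are conserved, so the outgoing
  vertical edge is determined.  The weight of an outgoing colour \<open>k > 0\<close> is a factor for its way
  through the vertex times a factor \<open>a\<close> or \<open>b\<close> for each other colour of \<open>I\<close>.

  Up to normalization these are weights of a coloured higher spin model.  The normalization clears
  all denominators: every weight is a polynomial in \<open>a\<close>, \<open>b\<close>, \<open>x\<close> with nonnegative coefficients.
\<close>

definition passing :: "'a::comm_ring_1 \<Rightarrow> 'a \<Rightarrow> nat \<Rightarrow> nat \<Rightarrow> 'a" where
  "passing a b k i = (if k < i then b else a)"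

definition crossing :: "'a::comm_ring_1 \<Rightarrow> 'a \<Rightarrow> nat set \<Rightarrow> nat \<Rightarrow> 'a" where
  "crossing a b I k = (\<Prod>i\<in>I - {k}. passing a b k i)"

definition route :: "'a::comm_ring_1 \<Rightarrow> 'a \<Rightarrow> 'a \<Rightarrow> nat \<Rightarrow> nat \<Rightarrow> 'a" where
  "route a b x h k =
    (if h = k then x
     else if h = 0 then (1 + a * x) * (1 + b * x)
     else if h < k then 1 + a * x
     else 1 + b * x)"

definition vertex_weight :: "'a::comm_ring_1 \<Rightarrow> 'a \<Rightarrow> 'a \<Rightarrow> nat set \<Rightarrow> nat \<Rightarrow> nat \<Rightarrow> 'a" where
  "vertex_weight a b x I h k =
    (if k = 0 then qint a b (Suc (card I)) + (if h = 0 then a * b * x * qint a b (card I) else 0)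
     else if k \<in> insert h I then route a b x h k * crossing a b I k
     else 0)"

definition vertical_out :: "nat set \<Rightarrow> nat \<Rightarrow> nat \<Rightarrow> nat set" where
  "vertical_out I h k = insert h I - {0, k}"

text \<open>
  Two neighbouring rows of one column, with parameters \<open>x\<close> and \<open>y\<close>, incoming colours \<open>h1\<close> and
  \<open>h2\<close>, outgoing colours \<open>k1\<close> and \<open>k2\<close>.  The row of \<open>y\<close> has the larger index and is passed first.
\<close>

definition pair_weight :: "'a::comm_ring_1 \<Rightarrow> 'a \<Rightarrow> 'a \<Rightarrow> 'a \<Rightarrow> nat set \<Rightarrow> nat \<Rightarrow> nat \<Rightarrow> nat \<Rightarrow> nat \<Rightarrow> 'a" where
  "pair_weight a b x y I h1 h2 k1 k2 = vertex_weight a b y I h2 k2 * vertex_weight a b x (vertical_out I h2 k2) h1 k1"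

text \<open>
  The two coefficients of the relation
  \<open>P\<^sub>i s\<^sub>i (F w) = diag F w + exch F (w s\<^sub>i)\<close>, where \<open>x = x\<^sub>i\<close>, \<open>y = x\<^bsub>i+1\<^esub>\<close>, \<open>h = w i\<close> and
  \<open>k = w (i + 1)\<close>.  For \<open>0 < h < k\<close> it expresses \<open>T\<^sub>i (F w) = \<beta> F (w s\<^sub>i)\<close>, for \<open>0 < k < h\<close> it is
  then dictated by the quadratic relation, and for two empty edges it says that \<open>F w\<close> is
  symmetric in \<open>x\<^sub>i\<close> and \<open>x\<^bsub>i+1\<^esub>\<close>.  An empty edge next to a coloured one is not treated like a
  smallest colour.  This is the effect of removing from \<open>F w\<close> a power of \<open>b\<close> and, for each row \<open>j\<close>
  entered by a colour, a factor \<open>1 + b x\<^sub>j\<close>; with these factors the increasing word would not give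
  a monomial.
\<close>

definition diag :: "'a::comm_ring_1 \<Rightarrow> 'a \<Rightarrow> 'a \<Rightarrow> 'a \<Rightarrow> nat \<Rightarrow> nat \<Rightarrow> 'a" where
  "diag a b x y h k =
    (if h = k then 1 + (a + b) * y + a * b * x * y
     else if h = 0 then (1 + a * y) * (1 + b * y)
     else if k = 0 then (1 + a * x) * (1 + b * x)
     else if h < k then (1 + b * x) * (1 + a * y)
     else (1 + a * x) * (1 + b * y))"

definition exch :: "'a::comm_ring_1 \<Rightarrow> 'a \<Rightarrow> 'a \<Rightarrow> 'a \<Rightarrow> nat \<Rightarrow> nat \<Rightarrow> 'a" where
  "exch a b x y h k =
    (if h = k then 0
     else if h = 0 then a * b * (y - x)
     else if k = 0 then y - x
     else if h < k then b * (y - x)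
     else a * (y - x))"

lemma vertex_weight_eq_0: "k \<notin> insert 0 (insert h I) \<Longrightarrow> vertex_weight a b x I h k = 0"
  by (simp add: vertex_weight_def)

lemma crossing_insert:
  "finite J \<Longrightarrow> c \<notin> J \<Longrightarrow> c \<noteq> k \<Longrightarrow> crossing a b (insert c J) k = passing a b k c * crossing a b J k"
  by (simp add: crossing_def insert_Diff_if)

lemma crossing_insert_same [simp]: "crossing a b (insert k J) k = crossing a b J k"
  by (simp add: crossing_def)

lemma Diff_zero_other: "0 \<notin> J \<Longrightarrow> k \<notin> J \<Longrightarrow> J - {0, k} = J"
  "0 \<notin> J \<Longrightarrow> J - {0} = J"
  by auto

text \<open>
  The identity that carries the relation with coefficients \<open>diag\<close> and \<open>exch\<close> from the right of a
  column to its left: the left-hand side interchanges the parameters and then applies the relation to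
  the outgoing colours, the right-hand side applies it to the incoming colours.  It compares the
  contributions of one final configuration \<open>k1, k2\<close>.
\<close>

definition exchanges :: "'a::comm_ring_1 \<Rightarrow> 'a \<Rightarrow> 'a \<Rightarrow> 'a \<Rightarrow> nat set \<Rightarrow> nat \<Rightarrow> nat \<Rightarrow> nat \<Rightarrow> nat \<Rightarrow> bool" where
  "exchanges a b x y I h1 h2 k1 k2 \<longleftrightarrow>
     diag a b x y k1 k2 * pair_weight a b y x I h1 h2 k1 k2 + exch a b x y k2 k1 * pair_weight a b y x I h1 h2 k2 k1
   = diag a b x y h1 h2 * pair_weight a b x y I h1 h2 k1 k2 + exch a b x y h1 h2 * pair_weight a b x y I h2 h1 k1 k2"

lemma pair_weight_both:
  assumes J: "finite J" "0 \<notin> J" and "k1 \<notin> J" "k2 \<notin> J" "k1 \<noteq> k2" "k1 \<notin> {0, h2}" "k2 \<notin> {0, h2}" "h2 \<notin> J"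
  shows "pair_weight a b x y (insert k1 (insert k2 J)) h1 h2 k1 k2 =
    route a b y h2 k2 * route a b x h1 k1 * passing a b k2 k1 * (if h2 = 0 then 1 else passing a b k1 h2) *
    (crossing a b J k1 * crossing a b J k2)"
proof -
  have "vertical_out (insert k1 (insert k2 J)) h2 k2 = (if h2 = 0 then insert k1 J else insert h2 (insert k1 J))"
    using assms J by (auto simp: vertical_out_def)
  then show ?thesis
    using assms J by (simp add: pair_weight_def vertex_weight_def crossing_insert insert_commute[of k1 k2])
qed

text \<open>
  The identity is verified according to which of \<open>k1\<close> and \<open>k2\<close> come from the vertical edge.  Here
  \<open>J\<close> is the set of the other colours of that edge.  It enters all four terms only through its size and
  a common product, so that only the relative order of the at most four remaining colours matters, and
  each order leaves a polynomial identity.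
\<close>

context
  fixes h1 h2 :: nat and J :: "nat set"
  assumes J: "finite J" "0 \<notin> J" "h1 \<notin> J" "h2 \<notin> J"
    and h: "h1 = h2 \<Longrightarrow> h1 = 0"
  notes qint.simps(2) [simp del]
begin

lemmas eval = pair_weight_def vertex_weight_def vertical_out_def diag_def exch_def route_def passing_def crossing_insert
  insert_Diff_if Diff_zero_other qint_rec

lemma exchanges_none:
  assumes "k1 \<in> {0, h1, h2}" "k2 \<in> {0, h1, h2}"
  shows "exchanges a b x y J h1 h2 k1 k2"
proof -
  have "h1 = 0 \<or> h1 \<noteq> 0" "h2 = 0 \<or> h2 \<noteq> 0" "h1 < h2 \<or> h2 < h1 \<or> h1 = h2" by auto
  with assms J h show ?thesis unfolding exchanges_def insert_iff empty_iff
    by (elim disjE FalseE) (simp_all add: eval, simp_all add: algebra_simps)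
qed

lemma exchanges_left:
  assumes "k1 \<notin> J" "k1 \<notin> {0, h1, h2}" "k2 \<in> {0, h1, h2}"
  shows "exchanges a b x y (insert k1 J) h1 h2 k1 k2"
proof -
  have "h1 = 0 \<or> h1 \<noteq> 0" "h2 = 0 \<or> h2 \<noteq> 0" "h1 < h2 \<or> h2 < h1 \<or> h1 = h2"
     "h1 < k1 \<or> k1 < h1" "h2 < k1 \<or> k1 < h2" using assms by auto
  with assms J h show ?thesis unfolding exchanges_def insert_iff empty_iff
    by (elim disjE FalseE) (simp_all add: eval, simp_all add: algebra_simps)
qed

lemma exchanges_right:
  assumes "k2 \<notin> J" "k2 \<notin> {0, h1, h2}" "k1 \<in> {0, h1, h2}"
  shows "exchanges a b x y (insert k2 J) h1 h2 k1 k2"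
proof -
  have "h1 = 0 \<or> h1 \<noteq> 0" "h2 = 0 \<or> h2 \<noteq> 0" "h1 < h2 \<or> h2 < h1 \<or> h1 = h2"
     "h1 < k2 \<or> k2 < h1" "h2 < k2 \<or> k2 < h2" using assms by auto
  with assms J h show ?thesis unfolding exchanges_def insert_iff empty_iff
    by (elim disjE FalseE) (simp_all add: eval, simp_all add: algebra_simps)
qed


lemma exchanges_both:
  assumes k: "k1 \<notin> J" "k2 \<notin> J" "k1 \<noteq> k2" "k1 \<notin> {0, h1, h2}" "k2 \<notin> {0, h1, h2}"
  shows "exchanges a b x y (insert k1 (insert k2 J)) h1 h2 k1 k2"
proof -
  let ?t = "\<lambda>k h. if h = 0 then 1 else passing a b k h"
  have ne: "h1 \<noteq> k1" "h1 \<noteq> k2" "h2 \<noteq> k1" "h2 \<noteq> k2" "k1 \<noteq> k2" "k1 \<noteq> 0" "k2 \<noteq> 0"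
    using k by auto
  note defs = diag_def exch_def route_def passing_def
  have E: "diag a b x y k1 k2 * (route a b x h2 k2 * route a b y h1 k1 * passing a b k2 k1 * ?t k1 h2)
      + exch a b x y k2 k1 * (route a b x h2 k1 * route a b y h1 k2 * passing a b k1 k2 * ?t k2 h2)
      = diag a b x y h1 h2 * (route a b y h2 k2 * route a b x h1 k1 * passing a b k2 k1 * ?t k1 h2)
      + exch a b x y h1 h2 * (route a b y h1 k2 * route a b x h2 k1 * passing a b k2 k1 * ?t k1 h1)" (is ?E)
  proof -
    consider "h1 = 0" "h2 = 0" | "h1 = 0" "h2 \<noteq> 0" | "h1 \<noteq> 0" "h2 = 0" | "h1 \<noteq> 0" "h2 \<noteq> 0" "h1 \<noteq> h2"
      using h by blast
    then show ?E
    proof cases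
      case 1
      show ?thesis unfolding defs 1 using ne
        by (cases "k1 < k2") (simp_all, simp_all add: algebra_simps)
    next
      case 2
      show ?thesis unfolding defs 2(1) using ne 2(2)
        by (cases "h2 < k1"; cases "h2 < k2"; cases "k1 < k2";
            (rule FalseE, linarith) | (simp, simp add: algebra_simps))
    next
      case 3
      show ?thesis unfolding defs 3(2) using ne 3(1)
        by (cases "h1 < k1"; cases "h1 < k2"; cases "k1 < k2";
            (rule FalseE, linarith) | (simp, simp add: algebra_simps))
    next
      case 4
      show ?thesis unfolding defs using ne 4
        by (cases "h1 < h2"; cases "h1 < k1"; cases "h1 < k2"; cases "h2 < k1"; cases "h2 < k2"; cases "k1 < k2";
            (rule FalseE, linarith) | (simp, simp add: algebra_simps))
    qed
  qed
  \<comment> \<open>The common contribution of the colours that stay on the vertical edge throughout.\<close>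
  define c where "c = crossing a b J k1 * crossing a b J k2"
  have pair_weight: "pair_weight a b x y (insert k1 (insert k2 J)) h h' k1 k2 =
      route a b y h' k2 * route a b x h k1 * passing a b k2 k1 * ?t k1 h' * c"
    "pair_weight a b x y (insert k1 (insert k2 J)) h h' k2 k1 =
      route a b y h' k1 * route a b x h k2 * passing a b k1 k2 * ?t k2 h' * c"
    if "h' \<in> {h1, h2}" for x y h h'
  proof -
    have h': "k1 \<notin> {0, h'}" "k2 \<notin> {0, h'}" "h' \<notin> J" using that ne J by auto
    show "pair_weight a b x y (insert k1 (insert k2 J)) h h' k1 k2 =
      route a b y h' k2 * route a b x h k1 * passing a b k2 k1 * ?t k1 h' * c"
      unfolding c_def by (rule pair_weight_both[OF J(1,2) k(1-3) h'])
    have "pair_weight a b x y (insert k2 (insert k1 J)) h h' k2 k1 =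
      route a b y h' k1 * route a b x h k2 * passing a b k1 k2 * ?t k2 h' * (crossing a b J k2 * crossing a b J k1)"
      by (rule pair_weight_both[OF J(1,2) k(2,1) k(3)[symmetric] h'(2,1,3)])
    then show "pair_weight a b x y (insert k1 (insert k2 J)) h h' k2 k1 =
      route a b y h' k1 * route a b x h k2 * passing a b k1 k2 * ?t k2 h' * c"
      by (simp only: c_def insert_commute[of k2] mult.commute[of "crossing a b J k2"])
  qed
  show ?thesis
    unfolding exchanges_def using arg_cong[OF E, of "\<lambda>z. z * c"]
    by (simp only: pair_weight insertI1 insertI2 mult.assoc distrib_right)
qed

end

text \<open>
  All four terms vanish unless \<open>k1\<close> and \<open>k2\<close> are available and distinct or empty, which leaves the
  four cases above.
\<close>

theorem exchange_identity:
  assumes I: "finite I" "0 \<notin> I" "h1 \<notin> I" "h2 \<notin> I" and h: "h1 = h2 \<Longrightarrow> h1 = 0"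
  shows "exchanges a b x y I h1 h2 k1 k2"
proof -
  have pair_weight_eq_0: "pair_weight a b x y I h h' k k' = 0"
    if "k' \<notin> insert 0 (insert h (insert h' I)) \<or> k \<notin> insert 0 (insert h (insert h' I)) \<or> k = k' \<and> k \<in> I"
      "h \<notin> I" for x y h h' k k'
  proof (cases "k' \<in> insert 0 (insert h' I)")
    case True
    with that consider "k \<notin> insert 0 (insert h (insert h' I))" | "k = k'" "k \<in> I"
      by blast
    then have "k \<notin> insert 0 (insert h (vertical_out I h' k'))"
    proof cases
      case 2
      then have "k \<noteq> 0" "k \<noteq> h" using I(2) that(2) by metis+
      with 2 show ?thesis by (simp add: vertical_out_def)
    qed (simp add: vertical_out_def)
    then show ?thesis by (simp add: pair_weight_def vertex_weight_eq_0 del: insert_iff)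
  next
    case False
    then show ?thesis by (simp add: pair_weight_def vertex_weight_eq_0 del: insert_iff)
  qed
  define J where "J = I - {k1, k2}"
  have J: "finite J" "0 \<notin> J" "h1 \<notin> J" "h2 \<notin> J" "k1 \<notin> J" "k2 \<notin> J"
    using I by (auto simp: J_def)
  have old: "k \<notin> {0, h1, h2}" if "k \<in> I" for k
    using that I(2-4) by (metis insertE empty_iff)
  consider (zero) "k1 \<notin> insert 0 (insert h1 (insert h2 I)) \<or> k2 \<notin> insert 0 (insert h1 (insert h2 I)) \<or> k1 = k2 \<and> k1 \<in> I"
    | (none) "k1 \<in> {0, h1, h2}" "k2 \<in> {0, h1, h2}"
    | (left) "k1 \<in> I" "k2 \<in> {0, h1, h2}"
    | (right) "k2 \<in> I" "k1 \<in> {0, h1, h2}"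
    | (both) "k1 \<in> I" "k2 \<in> I" "k1 \<noteq> k2"
    by blast
  then show ?thesis
  proof cases
    case zero
    then have "pair_weight a b x y I h1 h2 k k' = 0" "pair_weight a b x y I h2 h1 k k' = 0"
      if "k = k1 \<and> k' = k2 \<or> k = k2 \<and> k' = k1" for x y k k'
      using that I(3,4) by - (rule pair_weight_eq_0; auto)+
    then show ?thesis unfolding exchanges_def by simp
  next
    case none
    then have eq: "I = J" using I by (auto simp: J_def)
    show ?thesis unfolding eq by (rule exchanges_none[OF J(1-4) h none])
  next
    case left
    then have eq: "I = insert k1 J" using I by (auto simp: J_def)
    show ?thesis unfolding eq by (rule exchanges_left[OF J(1-4) h J(5) old[OF left(1)] left(2)])
  next
    case right
    then have eq: "I = insert k2 J" using I by (auto simp: J_def)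
    show ?thesis unfolding eq by (rule exchanges_right[OF J(1-4) h J(6) old[OF right(1)] right(2)])
  next
    case both
    then have eq: "I = insert k1 (insert k2 J)" by (auto simp: J_def)
    show ?thesis unfolding eq by (rule exchanges_both[OF J(1-4) h J(5,6) both(3) old[OF both(1)] old[OF both(2)]])
  qed
qed

section \<open>Partition functions and divided differences\<close>

text \<open>
  A function \<open>\<Phi>\<close> of a colour set and a word is the partition function of what remains of the
  model: \<open>I\<close> is the current vertical edge, and \<open>w\<close> lists the horizontal edges, with outgoing colours in
  the rows already passed in this column and incoming ones in the others.  The sum
  may run over all colours, since an unavailable colour has weight zero.
\<close>

definition row :: "'a::comm_ring_1 \<Rightarrow> 'a \<Rightarrow> nat \<Rightarrow> nat \<Rightarrow> (nat set \<Rightarrow> (nat \<Rightarrow> nat) \<Rightarrow> 'a mpoly) \<Rightarrow>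
    nat set \<Rightarrow> (nat \<Rightarrow> nat) \<Rightarrow> 'a mpoly" where
  "row a b n j \<Phi> I w = (\<Sum>k\<le>n. vertex_weight (C a) (C b) (X j) I (w j) k * \<Phi> (vertical_out I (w j) k) (w(j := k)))"

fun rows :: "'a::comm_ring_1 \<Rightarrow> 'a \<Rightarrow> nat \<Rightarrow> nat \<Rightarrow> (nat set \<Rightarrow> (nat \<Rightarrow> nat) \<Rightarrow> 'a mpoly) \<Rightarrow>
    nat set \<Rightarrow> (nat \<Rightarrow> nat) \<Rightarrow> 'a mpoly" where
  "rows a b n 0 \<Phi> = \<Phi>"
| "rows a b n (Suc m) \<Phi> = row a b n (Suc m) (rows a b n m \<Phi>)"

text \<open>
  The column for the colour \<open>c\<close> stands to the left of those for \<open>c - 1, \<dots>, 1\<close>, and all horizontal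
  edges are empty at the right end.
\<close>

fun partition_fun :: "'a::comm_ring_1 \<Rightarrow> 'a \<Rightarrow> nat \<Rightarrow> nat \<Rightarrow> (nat \<Rightarrow> nat) \<Rightarrow> 'a mpoly" where
  "partition_fun a b n 0 w = (if \<forall>j\<in>{1..n}. w j = 0 then 1 else 0)"
| "partition_fun a b n (Suc c) w = rows a b n n (\<lambda>I v. if I = {Suc c} then partition_fun a b n c v else 0) {} w"

text \<open>
  No colour occurs twice.  Conservation of colours propagates this through the model, and the exchange
  identity needs it.
\<close>

definition admissible :: "nat \<Rightarrow> nat set \<Rightarrow> (nat \<Rightarrow> nat) \<Rightarrow> bool" where
  "admissible n I w \<longleftrightarrow> finite I \<and> 0 \<notin> I \<and> (\<forall>j\<in>{1..n}. w j \<notin> I) \<and>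
     (\<forall>i\<in>{1..n}. \<forall>j\<in>{1..n}. w i = w j \<longrightarrow> w i = 0 \<or> i = j)"

lemma admissible_step:
  assumes adm: "admissible n I w" and j: "j \<in> {1..n}" and k: "k \<in> insert 0 (insert (w j) I)"
  shows "admissible n (vertical_out I (w j) k) (w(j := k))"
proof -
  have fresh: "w i \<notin> insert (w j) I" if "i \<in> {1..n}" "i \<noteq> j" "w i \<noteq> 0" for i
  proof -
    have "w i \<notin> I" and "w i = w j \<longrightarrow> w i = 0 \<or> i = j"
      using adm j that(1) unfolding admissible_def by simp_all
    with that(2,3) have "w i \<notin> I" "w i \<noteq> w j" by auto
    then show ?thesis by simp
  qed
  have "(w(j := k)) i \<notin> vertical_out I (w j) k" if "i \<in> {1..n}" for i
    using fresh[OF that] by (auto simp: vertical_out_def)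
  moreover have "(w(j := k)) i = 0 \<or> i = i'"
    if i: "i \<in> {1..n}" "i' \<in> {1..n}" and eq: "(w(j := k)) i = (w(j := k)) i'" for i i'
  proof -
    have "w l = 0 \<or> w l \<noteq> k" if "l \<in> {1..n}" "l \<noteq> j" for l
      using fresh[OF that] k by auto
    moreover have "w i = w i' \<longrightarrow> w i = 0 \<or> i = i'"
      using adm i unfolding admissible_def by simp
    ultimately show ?thesis
      using i eq by (cases "i = j"; cases "i' = j") auto
  qed
  ultimately show ?thesis
    using adm unfolding admissible_def by (simp add: vertical_out_def)
qed

lemma pair_weight_support:
  assumes "pair_weight a b x y I h1 h2 k1 k2 \<noteq> 0"
  shows "k2 \<in> insert 0 (insert h2 I)" "k1 \<in> insert 0 (insert h1 (vertical_out I h2 k2))"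
proof -
  have "vertex_weight a b y I h2 k2 \<noteq> 0" "vertex_weight a b x (vertical_out I h2 k2) h1 k1 \<noteq> 0"
    using assms unfolding pair_weight_def by (metis mult_zero_left, metis mult_zero_right)
  then show "k2 \<in> insert 0 (insert h2 I)" "k1 \<in> insert 0 (insert h1 (vertical_out I h2 k2))"
    by (metis vertex_weight_eq_0)+
qed

lemma vertical_out_twice:
  assumes "k2 \<in> insert 0 (insert h2 I)" "0 \<notin> I" "h1 \<notin> I" "h1 = h2 \<Longrightarrow> h1 = 0"
  shows "vertical_out (vertical_out I h2 k2) h1 k1 = I \<union> {h1, h2} - {0, k1, k2}"
proof -
  have "h1 = k2 \<Longrightarrow> h1 = 0" using assms by blast
  then show ?thesis unfolding vertical_out_def by blast
qed

definition exchange_rel :: "'a::comm_ring_1 \<Rightarrow> 'a \<Rightarrow> nat \<Rightarrow> nat \<Rightarrow> (nat set \<Rightarrow> (nat \<Rightarrow> nat) \<Rightarrow> 'a mpoly) \<Rightarrow> bool" where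
  "exchange_rel a b n i \<Phi> \<longleftrightarrow> (\<forall>I w. admissible n I w \<longrightarrow>
     (1 + (C a + C b) * X (Suc i) + C a * C b * X i * X (Suc i)) * swap_vars i (\<Phi> I w) =
     diag (C a) (C b) (X i) (X (Suc i)) (w i) (w (Suc i)) * \<Phi> I w +
     exch (C a) (C b) (X i) (X (Suc i)) (w i) (w (Suc i)) * \<Phi> I (w \<circ> transpose i (Suc i)))"

lemma subst_qint: "subst \<sigma> (qint (C a) (C b) m) = qint (C a) (C b) m"
  by (induction m) (simp_all add: subst_hom)

lemma subst_crossing: "subst \<sigma> (crossing (C a) (C b) I k) = crossing (C a) (C b) I k"
  by (simp add: crossing_def passing_def subst_prod if_distrib[of "subst \<sigma>"] cong: if_cong)

lemma subst_vertex_weight: "subst \<sigma> (vertex_weight (C a) (C b) x I h k) = vertex_weight (C a) (C b) (subst \<sigma> x) I h k"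
  unfolding vertex_weight_def route_def by (simp add: subst_hom subst_qint subst_crossing if_distrib[of "subst \<sigma>"] del: qint.simps cong: if_cong)

text \<open>
  A row other than \<open>i\<close> and \<open>i + 1\<close> neither involves the two variables nor the two colours, so it
  commutes with everything in the relation.
\<close>

lemma exchange_rel_row_other:
  assumes "exchange_rel a b n i \<Phi>" "j \<in> {1..n}" "j \<noteq> i" "j \<noteq> Suc i"
  shows "exchange_rel a b n i (row a b n j \<Phi>)"
  unfolding exchange_rel_def
proof (intro allI impI)
  fix I w assume adm: "admissible n I w"
  let ?P = "1 + (C a + C b) * X (Suc i) + C a * C b * X i * X (Suc i)"
  let ?D = "diag (C a) (C b) (X i) (X (Suc i)) (w i) (w (Suc i))"
  let ?E = "exch (C a) (C b) (X i) (X (Suc i)) (w i) (w (Suc i))"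
  let ?s = "transpose i (Suc i)"
  let ?w = "vertex_weight (C a) (C b) (X j) I (w j)"
  have t: "?s j = j" using assms by (simp add: transpose_def)
  have "?P * (?w k * swap_vars i (\<Phi> (vertical_out I (w j) k) (w(j := k)))) =
      ?D * (?w k * \<Phi> (vertical_out I (w j) k) (w(j := k))) +
      ?E * (vertex_weight (C a) (C b) (X j) I ((w \<circ> ?s) j) k * \<Phi> (vertical_out I ((w \<circ> ?s) j) k) ((w \<circ> ?s)(j := k)))" for k
  proof (cases "k \<in> insert 0 (insert (w j) I)")
    case True
    have "(w(j := k)) \<circ> ?s = (w \<circ> ?s)(j := k)"
      using assms by (auto simp: fun_eq_iff transpose_def)
    moreover have "admissible n (vertical_out I (w j) k) (w(j := k))"
      using True assms adm by (intro admissible_step)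
    ultimately have "?P * swap_vars i (\<Phi> (vertical_out I (w j) k) (w(j := k))) =
      ?D * \<Phi> (vertical_out I (w j) k) (w(j := k)) + ?E * \<Phi> (vertical_out I (w j) k) ((w \<circ> ?s)(j := k))"
      using assms unfolding exchange_rel_def by fastforce
    then have "?w k * (?P * swap_vars i (\<Phi> (vertical_out I (w j) k) (w(j := k)))) =
      ?w k * (?D * \<Phi> (vertical_out I (w j) k) (w(j := k)) + ?E * \<Phi> (vertical_out I (w j) k) ((w \<circ> ?s)(j := k)))"
      by simp
    then show ?thesis by (simp add: t algebra_simps)
  qed (simp add: vertex_weight_eq_0 t)
  then show "?P * swap_vars i (row a b n j \<Phi> I w) =
      ?D * row a b n j \<Phi> I w + ?E * row a b n j \<Phi> I (w \<circ> ?s)"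
    unfolding row_def by (simp add: subst_sum subst_mult subst_vertex_weight t sum_distrib_left sum.distrib del: o_apply)
qed

text \<open>
  Both sides are sums over the outgoing colours of the two rows.  The relation for \<open>\<Phi>\<close> turns the left
  side into a combination of the values of \<open>\<Phi>\<close> at \<open>(k1, k2)\<close> and \<open>(k2, k1)\<close>; after renaming the summation
  variables of the latter, the coefficients agree by the exchange identity.
\<close>

lemma exchange_rel_row_pair:
  assumes \<Phi>: "exchange_rel a b n i \<Phi>" and i: "i \<in> {1..n}" "Suc i \<in> {1..n}"
  shows "exchange_rel a b n i (row a b n (Suc i) (row a b n i \<Phi>))"
  unfolding exchange_rel_def
proof (intro allI impI)
  fix I w assume adm: "admissible n I w"
  let ?a = "C a" and ?b = "C b" and ?x = "X i" and ?y = "X (Suc i)"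
  let ?P = "1 + (?a + ?b) * ?y + ?a * ?b * ?x * ?y"
  let ?D = "diag ?a ?b ?x ?y" and ?E = "exch ?a ?b ?x ?y"
  let ?s = "transpose i (Suc i)"
  define h1 h2 where "h1 = w i" and "h2 = w (Suc i)"
  \<comment> \<open>The situation after both rows; by conservation of colours it is the same for \<open>(h1, h2)\<close> and \<open>(h2, h1)\<close>.\<close>
  define W where "W k1 k2 = w(i := k1, Suc i := k2)" for k1 k2
  define U where "U k1 k2 = I \<union> {h1, h2} - {0, k1, k2}" for k1 k2
  let ?F = "\<lambda>k1 k2. \<Phi> (U k1 k2) (W k1 k2)"
  have "\<forall>j\<in>{1..n}. w i = w j \<longrightarrow> w i = 0 \<or> i = j"
    using adm i(1) unfolding admissible_def by simp
  from bspec[OF this i(2)] have adm': "finite I" "0 \<notin> I" "h1 \<notin> I" "h2 \<notin> I" "h1 = h2 \<Longrightarrow> h1 = 0"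
    using adm i unfolding admissible_def h1_def h2_def by simp_all
  have expand: "row a b n (Suc i) (row a b n i \<Phi>) I v =
      (\<Sum>k2\<le>n. \<Sum>k1\<le>n. pair_weight ?a ?b ?x ?y I (v i) (v (Suc i)) k1 k2 * ?F k1 k2)"
    if v: "v = w \<or> v = w \<circ> ?s" for v
  proof -
    have "vertex_weight ?a ?b ?y I (v (Suc i)) k2 * (vertex_weight ?a ?b ?x (vertical_out I (v (Suc i)) k2) (v i) k1 *
         \<Phi> (vertical_out (vertical_out I (v (Suc i)) k2) (v i) k1) (v(Suc i := k2, i := k1))) =
       pair_weight ?a ?b ?x ?y I (v i) (v (Suc i)) k1 k2 * ?F k1 k2" for k1 k2
    proof (cases "pair_weight ?a ?b ?x ?y I (v i) (v (Suc i)) k1 k2 = 0")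
      case True
      then show ?thesis by (simp add: pair_weight_def flip: mult.assoc)
    next
      case False
      have vi: "v i = h1 \<and> v (Suc i) = h2 \<or> v i = h2 \<and> v (Suc i) = h1"
        using v by (auto simp: h1_def h2_def)
      then have "vertical_out (vertical_out I (v (Suc i)) k2) (v i) k1 = I \<union> {v i, v (Suc i)} - {0, k1, k2}"
        using adm' by (intro vertical_out_twice pair_weight_support(1)[OF False]) auto
      also have "\<dots> = U k1 k2"
        using vi unfolding U_def by blast
      finally have "vertical_out (vertical_out I (v (Suc i)) k2) (v i) k1 = U k1 k2" .
      moreover have "v(Suc i := k2, i := k1) = W k1 k2"
        using v by (auto simp: W_def fun_eq_iff transpose_def)
      ultimately show ?thesis by (simp add: pair_weight_def mult.assoc)
    qed
    then show ?thesis by (simp add: row_def sum_distrib_left)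
  qed
  have rel: "?P * (pair_weight ?a ?b ?y ?x I h1 h2 k1 k2 * swap_vars i (?F k1 k2)) =
      pair_weight ?a ?b ?y ?x I h1 h2 k1 k2 * (?D k1 k2 * ?F k1 k2 + ?E k1 k2 * ?F k2 k1)" for k1 k2
  proof (cases "pair_weight ?a ?b ?y ?x I h1 h2 k1 k2 = 0")
    case False
    note k = pair_weight_support[OF False]
    have "admissible n (U k1 k2) (W k1 k2)" 
    proof -
      have "admissible n (vertical_out I h2 k2) (w(Suc i := k2))"
        unfolding h2_def using k by (intro admissible_step[OF adm i(2)]) (simp add: h2_def)
      from admissible_step[OF this i(1), of k1]
      have "admissible n (vertical_out (vertical_out I h2 k2) h1 k1) (w(Suc i := k2, i := k1))"
        using k by (simp add: h1_def)
      moreover have "vertical_out (vertical_out I h2 k2) h1 k1 = U k1 k2" "w(Suc i := k2, i := k1) = W k1 k2"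
        unfolding U_def W_def using k(1) adm' by (intro vertical_out_twice) (auto simp: fun_upd_twist)
      ultimately show ?thesis by simp
    qed
    moreover have "W k1 k2 \<circ> ?s = W k2 k1" "U k1 k2 = U k2 k1" "W k1 k2 i = k1" "W k1 k2 (Suc i) = k2"
      by (auto simp: W_def U_def fun_eq_iff transpose_def)
    ultimately have "?P * swap_vars i (?F k1 k2) = ?D k1 k2 * ?F k1 k2 + ?E k1 k2 * ?F k2 k1"
      using \<Phi> unfolding exchange_rel_def by metis
    then show ?thesis by (simp add: mult.left_commute)
  qed simp
  have "?P * swap_vars i (row a b n (Suc i) (row a b n i \<Phi>) I w) =
     (\<Sum>k2\<le>n. \<Sum>k1\<le>n. ?P * (pair_weight ?a ?b ?y ?x I h1 h2 k1 k2 * swap_vars i (?F k1 k2)))"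
    by (simp add: expand subst_sum subst_mult pair_weight_def subst_vertex_weight sum_distrib_left h1_def h2_def)
  also have "\<dots> = (\<Sum>k2\<le>n. \<Sum>k1\<le>n. pair_weight ?a ?b ?y ?x I h1 h2 k1 k2 * (?D k1 k2 * ?F k1 k2)) +
      (\<Sum>k2\<le>n. \<Sum>k1\<le>n. pair_weight ?a ?b ?y ?x I h1 h2 k1 k2 * (?E k1 k2 * ?F k2 k1))"
    by (simp only: rel distrib_left sum.distrib)
  also have "(\<Sum>k2\<le>n. \<Sum>k1\<le>n. pair_weight ?a ?b ?y ?x I h1 h2 k1 k2 * (?E k1 k2 * ?F k2 k1)) =
      (\<Sum>k2\<le>n. \<Sum>k1\<le>n. pair_weight ?a ?b ?y ?x I h1 h2 k2 k1 * (?E k2 k1 * ?F k1 k2))"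
    by (rule sum.swap)
  also have "(\<Sum>k2\<le>n. \<Sum>k1\<le>n. pair_weight ?a ?b ?y ?x I h1 h2 k1 k2 * (?D k1 k2 * ?F k1 k2)) + \<dots> =
      (\<Sum>k2\<le>n. \<Sum>k1\<le>n. (?D k1 k2 * pair_weight ?a ?b ?y ?x I h1 h2 k1 k2 +
          ?E k2 k1 * pair_weight ?a ?b ?y ?x I h1 h2 k2 k1) * ?F k1 k2)"
    by (simp add: sum.distrib[symmetric] algebra_simps)
  also have "\<dots> = (\<Sum>k2\<le>n. \<Sum>k1\<le>n. (?D h1 h2 * pair_weight ?a ?b ?x ?y I h1 h2 k1 k2 +
          ?E h1 h2 * pair_weight ?a ?b ?x ?y I h2 h1 k1 k2) * ?F k1 k2)"
    by (simp only: exchange_identity[OF adm', unfolded exchanges_def])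
  also have "\<dots> = ?D h1 h2 * row a b n (Suc i) (row a b n i \<Phi>) I w +
      ?E h1 h2 * row a b n (Suc i) (row a b n i \<Phi>) I (w \<circ> ?s)"
    by (simp add: expand sum_distrib_left sum.distrib h1_def h2_def algebra_simps)
  finally show "?P * swap_vars i (row a b n (Suc i) (row a b n i \<Phi>) I w) =
      ?D (w i) (w (Suc i)) * row a b n (Suc i) (row a b n i \<Phi>) I w +
      ?E (w i) (w (Suc i)) * row a b n (Suc i) (row a b n i \<Phi>) I (w \<circ> ?s)"
    by (simp add: h1_def h2_def)
qed

lemma exchange_rel_rows:
  assumes "exchange_rel a b n i \<Phi>" "1 \<le> i" "Suc i \<le> m" "m \<le> n"
  shows "exchange_rel a b n i (rows a b n m \<Phi>)"
proof -
  have below: "exchange_rel a b n i (rows a b n k \<Phi>)" if "k < i" for k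
    using that assms by (induction k) (auto intro!: exchange_rel_row_other)
  obtain i' where i': "i = Suc i'" using assms by (cases i) auto
  show ?thesis using assms(3,4)
  proof (induction m rule: dec_induct)
    case base
    show ?case using below[of i'] assms
      unfolding i' rows.simps by (intro exchange_rel_row_pair) auto
  next
    case (step m)
    then show ?case using assms by (auto intro!: exchange_rel_row_other)
  qed
qed

text \<open>
  Induction on the number of columns, from the right: behind the last column the partition function is
  0 or 1 and depends symmetrically on the word.
\<close>

lemma exchange_partition_fun:
  assumes i: "1 \<le> i" "Suc i \<le> n" and w: "admissible n {} w"
  shows "(1 + (C a + C b) * X (Suc i) + C a * C b * X i * X (Suc i)) * swap_vars i (partition_fun a b n c w) =
     diag (C a) (C b) (X i) (X (Suc i)) (w i) (w (Suc i)) * partition_fun a b n c w +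
     exch (C a) (C b) (X i) (X (Suc i)) (w i) (w (Suc i)) * partition_fun a b n c (w \<circ> transpose i (Suc i))"
  using w
proof (induction c arbitrary: w)
  case 0
  let ?s = "transpose i (Suc i)"
  have "?s ` {1..n} = {1..n}"
    using i by (intro permutes_image permutes_swap_id) auto
  then have *: "(\<forall>j\<in>{1..n}. (w \<circ> ?s) j = 0) \<longleftrightarrow> (\<forall>j\<in>{1..n}. w j = 0)"
    by (metis (mono_tags, lifting) comp_apply image_iff)
  show ?case
  proof (cases "\<forall>j\<in>{1..n}. w j = 0")
    case True
    then have "w i = 0" "w (Suc i) = 0" using i by auto
    with True * show ?thesis by (simp add: diag_def exch_def del: o_apply)
  next
    case False
    with * have "\<not> (\<forall>j\<in>{1..n}. (w \<circ> ?s) j = 0)" by simp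
    with False show ?thesis unfolding partition_fun.simps by (simp only: if_False subst_0 mult_zero_right add_0)
  qed
next
  case (Suc c)
  let ?\<Phi> = "\<lambda>I v. if I = {Suc c} then partition_fun a b n c v else 0"
  have "exchange_rel a b n i ?\<Phi>"
    unfolding exchange_rel_def
  proof (intro allI impI)
    fix I :: "nat set" and v assume "admissible n I v"
    then have "admissible n {} v" by (simp add: admissible_def)
    from Suc.IH[OF this]
    show "(1 + (C a + C b) * X (Suc i) + C a * C b * X i * X (Suc i)) * swap_vars i (?\<Phi> I v) =
      diag (C a) (C b) (X i) (X (Suc i)) (v i) (v (Suc i)) * ?\<Phi> I v +
      exch (C a) (C b) (X i) (X (Suc i)) (v i) (v (Suc i)) * ?\<Phi> I (v \<circ> transpose i (Suc i))"
      by (cases "I = {Suc c}") (simp_all only: simp_thms if_True if_False subst_0 mult_zero_right add_0_right)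
  qed
  then have "exchange_rel a b n i (rows a b n n ?\<Phi>)"
    using i by (intro exchange_rel_rows) auto
  then show ?case
    using Suc.prems unfolding exchange_rel_def partition_fun.simps by blast
qed

text \<open>
  At an ascent the exchange relation and the definition of \<open>T\<^sub>i\<close> are the same equation, up to the factor
  \<open>x\<^bsub>i+1\<^esub> - x\<^sub>i\<close>, which is not a zero divisor.
\<close>

lemma T_op_partition_fun:
  fixes a b :: "'a::idom"
  assumes "1 \<le> i" "Suc i \<le> n" "admissible n {} w" "0 < w i" "w i < w (Suc i)"
  shows "T_op (- a) (- b) (a + b) i (partition_fun a b n c w) = C b * partition_fun a b n c (w \<circ> transpose i (Suc i))"
proof -
  have "(X (Suc i) - X i) * T_op (- a) (- b) (a + b) i (partition_fun a b n c w) =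
     (X (Suc i) - X i) * (C b * partition_fun a b n c (w \<circ> transpose i (Suc i)))"
    unfolding T_op_twisted exchange_partition_fun[OF assms(1-3)]
    using assms(4,5) by (simp add: diag_def exch_def algebra_simps)
  then show ?thesis by simp
qed

section \<open>The increasing word\<close>

text \<open>
  A colour that is neither on the vertical edge nor in a remaining row can no longer be emitted.
\<close>

lemma rows_lost:
  assumes "c \<notin> I" "\<And>j. j \<in> {1..m} \<Longrightarrow> w j \<noteq> c"
  shows "rows a b n m (\<lambda>I v. if I = {c} then f v else 0) I w = 0"
  using assms
proof (induction m arbitrary: I w)
  case (Suc m)
  have "rows a b n m (\<lambda>I v. if I = {c} then f v else 0) (vertical_out I (w (Suc m)) k) (w(Suc m := k)) = 0" for k
  proof (rule Suc.IH)
    show "c \<notin> vertical_out I (w (Suc m)) k"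
      using Suc.prems(1) Suc.prems(2)[of "Suc m"] by (simp add: vertical_out_def)
    show "(w(Suc m := k)) j \<noteq> c" if "j \<in> {1..m}" for j
      using that Suc.prems(2)[of j] by simp
  qed
  then show ?case by (simp add: row_def)
qed auto

text \<open>
  As long as all remaining rows are entered by a colour, the number of colours on the vertical edge
  cannot decrease, so it cannot come down to the single colour that has to be emitted.
\<close>

lemma rows_crowded:
  assumes "finite I" "0 \<notin> I" "2 \<le> card I" "\<And>j. j \<in> {1..m} \<Longrightarrow> w j = j \<and> j \<notin> I"
  shows "rows a b n m (\<lambda>I v. if I = {c} then f v else 0) I w = 0"
  using assms
proof (induction m arbitrary: I w)
  case (Suc m)
  have w: "w (Suc m) = Suc m" "Suc m \<notin> I"
    using Suc.prems(4)[of "Suc m"] by auto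
  have "rows a b n m (\<lambda>I v. if I = {c} then f v else 0) (vertical_out I (w (Suc m)) k) (w(Suc m := k)) = 0" for k
  proof (rule Suc.IH)
    have "card (insert (Suc m) I - {k}) \<ge> card (insert (Suc m) I) - 1"
      by (simp add: card_Diff_singleton_if)
    moreover have "vertical_out I (w (Suc m)) k = insert (Suc m) I - {k}"
      using w Suc.prems(2) by (auto simp: vertical_out_def)
    ultimately show "2 \<le> card (vertical_out I (w (Suc m)) k)"
      using w Suc.prems(1,3) by simp
    show "(w(Suc m := k)) j = j \<and> j \<notin> vertical_out I (w (Suc m)) k" if "j \<in> {1..m}" for j
      using that w Suc.prems(4)[of j] by (simp add: vertical_out_def)
  qed (use Suc.prems in \<open>auto simp: vertical_out_def\<close>)
  then show ?case by (simp add: row_def)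
qed auto

text \<open>
  Once the vertical edge carries exactly the colour \<open>c\<close>, the smaller colours of the remaining rows
  have to go straight on: entering the vertical edge crowds it or expels \<open>c\<close>.  Each of these
  crossings has weight \<open>b x\<^sub>j\<close>.
\<close>

lemma rows_single:
  assumes "m < c" "c \<le> n" "\<And>j. j \<in> {1..m} \<Longrightarrow> w j = j"
  shows "rows a b n m (\<lambda>I v. if I = {c} then f v else 0) {c} w = (\<Prod>j\<in>{1..m}. C b * X j) * f w"
  using assms
proof (induction m)
  case (Suc m)
  let ?K = "\<lambda>I v. if I = {c} then f v else 0"
  let ?g = "\<lambda>k. vertex_weight (C a) (C b) (X (Suc m)) {c} (w (Suc m)) k *
    rows a b n m ?K (vertical_out {c} (w (Suc m)) k) (w(Suc m := k))"
  have w: "w (Suc m) = Suc m" and wj: "\<And>j. j \<in> {1..m} \<Longrightarrow> w j = j"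
    using Suc.prems by auto
  have "?g k = (if k = Suc m then C b * X (Suc m) * rows a b n m ?K {c} w else 0)" for k
  proof -
    consider "k = Suc m" | "k = 0" | "k = c" "k \<noteq> Suc m" | "k \<notin> insert 0 (insert (w (Suc m)) {c})"
      using w by auto
    then show ?thesis
    proof cases
      case 1
      have "vertical_out {c} (Suc m) (Suc m) = {c}" "w(Suc m := Suc m) = w"
        using w Suc.prems by (auto simp: vertical_out_def fun_upd_idem)
      moreover have "crossing (C a) (C b) {c} (Suc m) = C b"
        using Suc.prems by (simp add: crossing_def passing_def)
      ultimately show ?thesis using 1 w by (simp add: vertex_weight_def route_def)
    next
      case 2
      have "rows a b n m ?K (vertical_out {c} (w (Suc m)) k) (w(Suc m := k)) = 0"
        using 2 w wj Suc.prems(1) by (intro rows_crowded) (auto simp: vertical_out_def)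
      with 2 show ?thesis by simp
    next
      case 3
      have "rows a b n m ?K (vertical_out {c} (w (Suc m)) k) (w(Suc m := k)) = 0"
        using 3 w wj Suc.prems(1) by (intro rows_lost) (auto simp: vertical_out_def)
      with 3 show ?thesis by simp
    next
      case 4
      then show ?thesis using w by (simp add: vertex_weight_eq_0 del: insert_iff) auto
    qed
  qed
  then have "rows a b n (Suc m) ?K {c} w = C b * X (Suc m) * rows a b n m ?K {c} w"
    using Suc.prems by (simp add: row_def)
  also have "rows a b n m ?K {c} w = (\<Prod>j\<in>{1..m}. C b * X j) * f w"
    using Suc by auto
  finally show ?case by (simp add: mult_ac)
qed simp

text \<open>
  The rows with an index above \<open>c + 1\<close> are empty and have weight 1, and row \<open>c + 1\<close> must hand its
  colour to the column, since it is the one to be emitted and no later row carries it.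
\<close>

lemma rows_sorted:
  assumes "Suc c \<le> m" "m \<le> n" "\<And>j. j \<in> {1..m} \<Longrightarrow> w j = (if j \<le> Suc c then j else 0)"
  shows "rows a b n m (\<lambda>I v. if I = {Suc c} then f v else 0) {} w =
    (\<Prod>j\<in>{1..c}. C b * X j) * f (w(Suc c := 0))"
  using assms
proof (induction m rule: dec_induct)
  case base
  let ?K = "\<lambda>I v. if I = {Suc c} then f v else 0"
  let ?g = "\<lambda>k. vertex_weight (C a) (C b) (X (Suc c)) {} (w (Suc c)) k *
    rows a b n c ?K (vertical_out {} (w (Suc c)) k) (w(Suc c := k))"
  have w: "w (Suc c) = Suc c" and wj: "\<And>j. j \<in> {1..c} \<Longrightarrow> w j = j"
    using base by auto
  have "?g k = (if k = 0 then (\<Prod>j\<in>{1..c}. C b * X j) * f (w(Suc c := 0)) else 0)" for k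
  proof -
    consider "k = 0" | "k = Suc c" | "k \<notin> insert 0 (insert (w (Suc c)) {})"
      using w by auto
    then show ?thesis
    proof cases
      case 1
      have "rows a b n c ?K {Suc c} (w(Suc c := 0)) = (\<Prod>j\<in>{1..c}. C b * X j) * f (w(Suc c := 0))"
        using wj base by (intro rows_single) auto
      moreover have "vertical_out {} (Suc c) 0 = {Suc c}" by (simp add: vertical_out_def)
      ultimately show ?thesis using 1 w by (simp add: vertex_weight_def)
    next
      case 2
      have "rows a b n c ?K (vertical_out {} (w (Suc c)) k) (w(Suc c := k)) = 0"
        using 2 w wj by (intro rows_lost) (auto simp: vertical_out_def)
      with 2 show ?thesis by simp
    next
      case 3
      then show ?thesis by (simp add: vertex_weight_eq_0 del: insert_iff) auto
    qed
  qed
  then have "rows a b n (Suc c) ?K {} w =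
      (\<Sum>k\<le>n. if k = 0 then (\<Prod>j\<in>{1..c}. C b * X j) * f (w(Suc c := 0)) else 0)"
    by (simp only: rows.simps row_def)
  also have "\<dots> = (\<Prod>j\<in>{1..c}. C b * X j) * f (w(Suc c := 0))"
    by (subst sum.delta) simp_all
  finally show ?case .
next
  case (step m)
  let ?K = "\<lambda>I v. if I = {Suc c} then f v else 0"
  have w: "w (Suc m) = 0" using step by auto
  have "vertex_weight (C a) (C b) (X (Suc m)) {} 0 k * rows a b n m ?K (vertical_out {} 0 k) (w(Suc m := k)) =
      (if k = 0 then rows a b n m ?K {} w else 0)" for k
    using w by (simp add: vertex_weight_def vertical_out_def fun_upd_idem)
  then have "rows a b n (Suc m) ?K {} w = rows a b n m ?K {} w"
    by (simp add: row_def w)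
  with step show ?case by auto
qed

lemma partition_fun_sorted:
  assumes "c \<le> n" "\<And>j. j \<in> {1..n} \<Longrightarrow> w j = (if j \<le> c then j else 0)"
  shows "\<exists>N. partition_fun a b n c w = C (b ^ N) * (\<Prod>i\<in>{1..c}. X i ^ (c - i))"
  using assms
proof (induction c arbitrary: w)
  case 0
  then show ?case by (auto intro!: exI[of _ 0])
next
  case (Suc c)
  have "\<exists>N. partition_fun a b n c (w(Suc c := 0)) = C (b ^ N) * (\<Prod>i\<in>{1..c}. X i ^ (c - i))"
    using Suc.prems by (intro Suc.IH) auto
  then obtain N where N: "partition_fun a b n c (w(Suc c := 0)) = C (b ^ N) * (\<Prod>i\<in>{1..c}. X i ^ (c - i))" ..
  have "partition_fun a b n (Suc c) w = (\<Prod>j\<in>{1..c}. C b * X j) * partition_fun a b n c (w(Suc c := 0))"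
    unfolding partition_fun.simps using Suc.prems by (intro rows_sorted) auto
  also have "\<dots> = C (b ^ (c + N)) * (\<Prod>i\<in>{1..c}. X i * X i ^ (c - i))"
    by (simp add: N prod.distrib C_power power_add C_mult mult_ac)
  also have "(\<Prod>i\<in>{1..c}. X i * X i ^ (c - i)) = (\<Prod>i\<in>{1..Suc c}. X i ^ (Suc c - i))"
    by (simp add: Suc_diff_le flip: power_Suc)
  finally show ?case by blast
qed

section \<open>Positivity of the partition functions\<close>

context coeff_semiring
begin

lemma polys_over_vertex_weight:
  assumes "a \<in> A" "b \<in> A" "x \<in> polys_over A V"
  shows "vertex_weight (C a) (C b) x I h k \<in> polys_over A V"
proof -
  have ab: "C a \<in> polys_over A V" "C b \<in> polys_over A V"
    using assms by (auto intro: polys_over_C)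
  have "qint (C a) (C b) m \<in> polys_over A V" for m
    by (induction m) (auto intro!: polys_over_closed ab)
  moreover have "crossing (C a) (C b) I k \<in> polys_over A V"
    unfolding crossing_def passing_def by (intro polys_over_prod) (simp add: ab)
  moreover have "route (C a) (C b) x h k \<in> polys_over A V"
    unfolding route_def using assms(3) by (auto intro!: polys_over_closed ab)
  ultimately show ?thesis
    unfolding vertex_weight_def using assms(3) by (auto intro!: polys_over_closed ab simp del: qint.simps)
qed

lemma polys_over_rows:
  assumes "a \<in> A" "b \<in> A" "m \<le> n" "\<And>I w. \<Phi> I w \<in> polys_over A {1..n}"
  shows "rows a b n m \<Phi> I w \<in> polys_over A {1..n}"
  using assms
  by (induction m arbitrary: I w) (auto simp: row_def intro!: polys_over_closed polys_over_vertex_weight)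

lemma polys_over_partition_fun:
  assumes "a \<in> A" "b \<in> A"
  shows "partition_fun a b n c w \<in> polys_over A {1..n}"
proof (induction c arbitrary: w)
  case (Suc c)
  show ?case
    unfolding partition_fun.simps by (intro polys_over_rows assms order_refl) (auto simp only: Suc.IH polys_over_0 split: if_split)
qed (simp add: polys_over_0 polys_over_1)

end

lemma coeff_semiring_poly:
  assumes "coeff_semiring B"
  shows "coeff_semiring {p. \<forall>i. coeff p i \<in> B}"
proof -
  interpret B: coeff_semiring B by fact
  have sum: "(\<And>i. i \<in> K \<Longrightarrow> g i \<in> B) \<Longrightarrow> (\<Sum>i\<in>K. g i) \<in> B" for g and K :: "nat set"
    by (induction K rule: infinite_finite_induct) (auto intro: B.add_mem)
  show ?thesis
    by standard (auto simp: coeff_mult coeff_1 intro!: B.add_mem sum B.mult_mem)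
qed

lemma coeff_semiring_nat_polys: "coeff_semiring nat_polys_\<alpha>\<beta>"
proof -
  have "coeff_semiring (\<nat> :: int set)" by standard auto
  from coeff_semiring_poly[OF coeff_semiring_poly[OF this]] show ?thesis
    by (simp add: nat_polys_\<alpha>\<beta>_def)
qed

lemma ind_mem: "ind_\<alpha> \<in> nat_polys_\<alpha>\<beta>" "ind_\<beta> \<in> nat_polys_\<alpha>\<beta>"
  by (auto simp: nat_polys_\<alpha>\<beta>_def ind_\<alpha>_def ind_\<beta>_def coeff_pCons split: nat.splits)

text \<open>
  Multiplication by the indeterminate shifts the coefficients.
\<close>

lemma nat_polys_cancel: "ind_\<beta> ^ N * p \<in> nat_polys_\<alpha>\<beta> \<Longrightarrow> p \<in> nat_polys_\<alpha>\<beta>"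
proof (induction N)
  case (Suc N)
  let ?q = "ind_\<beta> ^ N * p"
  have "coeff ?q i = coeff (ind_\<beta> ^ Suc N * p) (Suc i)" for i
    by (simp add: ind_\<beta>_def mult.assoc)
  with Suc.prems have "?q \<in> nat_polys_\<alpha>\<beta>"
    by (simp add: nat_polys_\<alpha>\<beta>_def)
  then show ?case by (rule Suc.IH)
qed simp

lemma lookup_C_mult: "Poly_Mapping.lookup (C c * f) m = c * Poly_Mapping.lookup f m"
  unfolding C_def by (simp flip: mult_map_scale_conv_mult add: Poly_Mapping.map.rep_eq when_def)

lemma polys_over_nat_cancel:
  assumes "C (ind_\<beta> ^ N) * f \<in> polys_over nat_polys_\<alpha>\<beta> V"
  shows "f \<in> polys_over nat_polys_\<alpha>\<beta> V"
proof -
  have "ind_\<beta> ^ N \<noteq> 0" by (simp add: ind_\<beta>_def)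
  then have "Poly_Mapping.keys (C (ind_\<beta> ^ N) * f) = Poly_Mapping.keys f"
    by (auto simp: in_keys_iff lookup_C_mult)
  with assms show ?thesis
    by (auto simp: polys_over_def lookup_C_mult intro: nat_polys_cancel)
qed

section \<open>Reduced words\<close>

lemma word_perm_simps [simp]:
  "word_perm [] = id" "word_perm (i # is) = transpose i (Suc i) \<circ> word_perm is"
  by (simp_all add: word_perm_def)

lemma word_perm_append: "word_perm (is @ js) = word_perm is \<circ> word_perm js"
  by (induction "is") (simp_all add: comp_assoc)

lemma word_perm_permutes: "set is \<subseteq> {1..n - 1} \<Longrightarrow> word_perm is permutes {1..n}"
  by (induction "is") (auto intro!: permutes_id permutes_compose permutes_swap_id)

lemma bij_word_perm: "bij (word_perm is)"
proof (induction "is")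
  case (Cons i "is")
  then show ?case unfolding word_perm_simps by (rule bij_comp) simp
qed (simp only: word_perm_simps bij_id)

lemma inv_word_perm_Cons: "inv (word_perm (i # is)) = inv (word_perm is) \<circ> transpose i (Suc i)"
  by (simp add: o_inv_distrib bij_word_perm)

lemma transpose_conj:
  "transpose j k \<circ> transpose (transpose j k p) (transpose j k q) = transpose p q \<circ> transpose j k"
proof
  fix x
  have "transpose j k x = r \<longleftrightarrow> x = transpose j k r" for r
    by (metis transpose_involutory)
  then show "(transpose j k \<circ> transpose (transpose j k p) (transpose j k q)) x =
      (transpose p q \<circ> transpose j k) x"
    by (simp add: transpose_def[of "transpose j k p"] transpose_def[of p])
qed

text \<open>
  The deletion condition: while the letters of \<open>js\<close> act one after the other on the pair \<open>p < q\<close>, its order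
  is reversed at some letter, and this can only be the transposition of the current images of
  \<open>p\<close> and \<open>q\<close>.  Deleting this letter multiplies by the transposition of \<open>p\<close> and \<open>q\<close>.
\<close>

lemma deletion_condition:
  assumes "p < q" "inv (word_perm js) q < inv (word_perm js) p"
  shows "\<exists>js'. set js' \<subseteq> set js \<and> Suc (length js') = length js \<and>
    word_perm js' = transpose p q \<circ> word_perm js"
  using assms
proof (induction js arbitrary: p q)
  case (Cons j js)
  let ?s = "transpose j (Suc j)"
  show ?case
  proof (cases "p = j \<and> q = Suc j")
    case True
    then show ?thesis by (intro exI[of _ js]) (auto simp flip: comp_assoc)
  next
    case False
    then have "?s p < ?s q"
      using Cons.prems(1) by (auto simp: transpose_def)
    moreover have "inv (word_perm js) (?s q) < inv (word_perm js) (?s p)"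
      using Cons.prems(2) by (simp only: inv_word_perm_Cons o_apply)
    ultimately obtain js' where js': "set js' \<subseteq> set js" "Suc (length js') = length js"
      "word_perm js' = transpose (?s p) (?s q) \<circ> word_perm js"
      using Cons.IH by blast
    then have "word_perm (j # js') = (?s \<circ> transpose (?s p) (?s q)) \<circ> word_perm js"
      by (simp add: comp_assoc)
    also have "\<dots> = transpose p q \<circ> word_perm (j # js)"
      by (simp only: transpose_conj word_perm_simps comp_assoc)
    finally show ?thesis using js' by (intro exI[of _ "j # js'"]) auto
  qed
qed simp

text \<open>
  If the first letter \<open>i\<close> met a descent, the deletion condition would provide a decomposition shorter
  by two.
\<close>

lemma reduced_decomposition_Cons:
  assumes "reduced_decomposition n w (i # is)"
  shows "reduced_decomposition n (word_perm is) is"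
    and "inv (word_perm is) i < inv (word_perm is) (Suc i)"
proof -
  have w: "w = transpose i (Suc i) \<circ> word_perm is" and i: "i \<in> {1..n - 1}" "set is \<subseteq> {1..n - 1}"
    and min: "\<And>js. decomposition n w js \<Longrightarrow> Suc (length is) \<le> length js"
    using assms by (auto simp: reduced_decomposition_def decomposition_def)
  have "length is \<le> length js" if "decomposition n (word_perm is) js" for js
    using min[of "i # js"] that i w by (simp add: decomposition_def)
  then show "reduced_decomposition n (word_perm is) is"
    using i by (simp add: reduced_decomposition_def decomposition_def)
  show "inv (word_perm is) i < inv (word_perm is) (Suc i)"
  proof (rule ccontr)
    assume "\<not> ?thesis"
    moreover have "inv (word_perm is) i \<noteq> inv (word_perm is) (Suc i)"
      using bij_imp_bij_inv[OF bij_word_perm] by (metis bij_pointE n_not_Suc_n)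
    ultimately obtain js where "set js \<subseteq> set is" "Suc (length js) = length is" "word_perm js = w"
      using deletion_condition[of i "Suc i" "is"] w by auto
    then show False
      using min[of js] i by (auto simp: decomposition_def)
  qed
qed

lemma transpose_word: "a < b \<Longrightarrow> \<exists>is. set is \<subseteq> {a..<b} \<and> word_perm is = transpose a b"
proof (induction b)
  case (Suc b)
  show ?case
  proof (cases "a = b")
    case True
    then show ?thesis by (intro exI[of _ "[a]"]) auto
  next
    case False
    then obtain "is" where is': "set is \<subseteq> {a..<b}" "word_perm is = transpose a b"
      using Suc by auto
    have "word_perm (b # is @ [b]) = transpose a (Suc b)"
      using False Suc.prems is'(2) by (auto simp: word_perm_append fun_eq_iff transpose_def)
    with is'(1) Suc.prems show ?thesis by (intro exI[of _ "b # is @ [b]"]) auto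
  qed
qed simp

lemma decomposition_exists:
  assumes "w permutes {1..n}"
  shows "\<exists>is. decomposition n w is"
  using assms finite_atLeastAtMost
proof (induction rule: permutes_induct)
  case id
  show ?case by (intro exI[of _ "[]"]) (simp add: decomposition_def fun_eq_iff)
next
  case (swap a b p)
  obtain js where js: "decomposition n p js" using swap by blast
  have "\<exists>is. set is \<subseteq> {1..n - 1} \<and> word_perm is = transpose a b"
    if "a \<in> {1..n}" "b \<in> {1..n}" "a < b" for a b :: nat
    using transpose_word[OF \<open>a < b\<close>] that by fastforce
  then obtain "is" where "set is \<subseteq> {1..n - 1}" "word_perm is = transpose a b"
    using swap.hyps by (metis linorder_neqE_nat transpose_commute)
  with js show ?case
    by (intro exI[of _ "is @ js"]) (auto simp: decomposition_def word_perm_append)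
qed

lemma reduced_decomposition_exists:
  assumes "w permutes {1..n}"
  shows "reduced_decomposition n w (SOME is. reduced_decomposition n w is)"
proof (rule someI_ex)
  show "\<exists>is. reduced_decomposition n w is"
    using decomposition_exists[OF assms] ex_has_least_nat[of "decomposition n w" _ length]
    unfolding reduced_decomposition_def by blast
qed

section \<open>Positivity of the twisted Kirillov polynomials\<close>

text \<open>
  The factor \<open>b ^ N\<close> is kept on the left so that the operators act on partition functions throughout.
  The word attached to a permutation is its inverse, because a letter multiplies the permutation on
  the left but interchanges two neighbouring entries of the word.
\<close>

lemma T_word_partition_fun:
  fixes a b :: "'a::idom"
  assumes "reduced_decomposition n w is"
    and N: "partition_fun a b n n (\<lambda>j. j) = C (b ^ N) * (\<Prod>i\<in>{1..n}. X i ^ (n - i))"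
  shows "C (b ^ N) * foldr (T_op (- a) (- b) (a + b)) is (\<Prod>i\<in>{1..n}. X i ^ (n - i)) =
    C (b ^ length is) * partition_fun a b n n (inv w)"
  using assms(1)
proof (induction "is" arbitrary: w)
  case Nil
  then have "inv w = (\<lambda>j. j)"
    by (simp add: reduced_decomposition_def decomposition_def inv_id id_def[symmetric])
  then show ?case by (simp add: N)
next
  case (Cons i "is")
  let ?T = "T_op (- a) (- b) (a + b)"
  let ?v = "word_perm is" and ?m = "\<Prod>i\<in>{1..n}. X i ^ (n - i)"
  have w: "w = word_perm (i # is)" and i: "1 \<le> i" "Suc i \<le> n" "set is \<subseteq> {1..n - 1}"
    using Cons.prems by (auto simp: reduced_decomposition_def decomposition_def)
  note red = reduced_decomposition_Cons[OF Cons.prems]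
  have perm: "inv ?v permutes {1..n}"
    using word_perm_permutes[OF i(3)] by (rule permutes_inv)
  have adm: "admissible n {} (inv ?v)"
    using permutes_inj[OF perm] by (auto simp: admissible_def dest: injD)
  have pos: "0 < inv ?v i"
    using permutes_in_image[OF perm, of i] i by simp
  have "C (b ^ N) * ?T i (foldr ?T is ?m) = ?T i (C (b ^ N) * foldr ?T is ?m)"
    by (simp only: T_op_C_mult)
  also have "\<dots> = C (b ^ length is) * ?T i (partition_fun a b n n (inv ?v))"
    by (simp only: Cons.IH[OF red(1)] T_op_C_mult)
  also have "?T i (partition_fun a b n n (inv ?v)) = C b * partition_fun a b n n (inv w)"
    unfolding w inv_word_perm_Cons by (rule T_op_partition_fun[OF i(1,2) adm pos red(2)])
  finally show ?case by (simp add: C_mult mult_ac)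
qed

theorem theorem5p8:
  fixes n :: nat and w :: "nat \<Rightarrow> nat"
  assumes "n \<ge> 2" and "w permutes {1..n}"
  shows "KN n (- ind_\<alpha>) (- ind_\<beta>) (ind_\<alpha> + ind_\<beta>) w \<in> polys_over nat_polys_\<alpha>\<beta> {1..n}"
proof -
  interpret coeff_semiring nat_polys_\<alpha>\<beta> by (rule coeff_semiring_nat_polys)
  obtain N where N: "partition_fun ind_\<alpha> ind_\<beta> n n (\<lambda>j. j) = C (ind_\<beta> ^ N) * (\<Prod>i\<in>{1..n}. X i ^ (n - i))"
    using partition_fun_sorted[of n n "\<lambda>j. j" ind_\<alpha> ind_\<beta>] by auto
  define js where "js = (SOME is. reduced_decomposition n w is)"
  have pow: "ind_\<beta> ^ k \<in> nat_polys_\<alpha>\<beta>" for k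
    by (induction k) (auto intro: mult_mem ind_mem)
  have "C (ind_\<beta> ^ N) * KN n (- ind_\<alpha>) (- ind_\<beta>) (ind_\<alpha> + ind_\<beta>) w =
      C (ind_\<beta> ^ length js) * partition_fun ind_\<alpha> ind_\<beta> n n (inv w)"
    unfolding KN_def T_perm_def js_def
    by (rule T_word_partition_fun[OF reduced_decomposition_exists[OF assms(2)] N])
  also have "\<dots> \<in> polys_over nat_polys_\<alpha>\<beta> {1..n}"
    by (intro polys_over_mult polys_over_C pow polys_over_partition_fun ind_mem)
  finally show ?thesis by (rule polys_over_nat_cancel)
qed

end
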